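(* Let $X$ be a coherent well-filtered space. Then its Scott power space $P_\sigma(X)$ is a coherent well-filtered space. Therefore, $P_\sigma(X)$ is a strong $R$-space, and hence it is strongly well-filtered.
   Context: For a $T_0$-space $X$: a subset is saturated if it equals the intersection of all open sets containing it; $Q(X)$ is the set of all nonempty compact saturated subsets of $X$ (compactness is the open-cover property), ordered by the Smyth order $K_1\sqsubseteq K_2\iff K_2\subseteq K_1$. A family $\mathcal K\subseteq Q(X)$ is filtered if it is nonempty and any two members contain a common member of $\mathcal K$. A $T_0$-space $X$ is: well-filtered if for every filtered $\mathcal K\subseteq Q(X)$ and open $U$, $\bigcap\mathcal K\subseteq U$ implies $K\subseteq U$ for some $K\in\mathcal K$; coherent if the intersection of any two compact saturated sets is compact; strongly well-filtered if for every filtered family $\{K_d: d\in D\}\subseteq Q(X)$, $K\in Q(X)$ and open $U$, $\bigcap_{d\in D}K_d\cap K\subseteq U$ implies $K_d\cap K\subseteq U$ for some $d\in D$; a strong $R$-space if for every nonempty family $\{K_i: i\in I\}\subseteq Q(X)$ and open $U$, $\bigcap_{i\in I}K_i\subseteq U$ implies $\bigcap_{i\in J}K_i\subseteq U$ for some nonempty finite $J\subseteq I$. A subset $U$ of a poset $P$ is Scott open if it is an upper set and, for every directed $D\subseteq P$ whose supremum exists, $\bigvee D\in U$ implies $D\cap U\neq\emptyset$; these sets form the Scott topology. The Scott power space $P_\sigma(X)$ is the poset $(Q(X),\sqsubseteq)$ equipped with its Scott topology. *)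

theory Defs
  imports "HOL-Analysis.Analysis" "HOL-Algebra.Order"
begin

(* The conjunct S \<subseteq> topspace X is needed because topspace X may be a proper subset of the type:
   for S not contained in topspace X the intersection below is over the empty family. *)
definition saturated_in :: "'a topology \<Rightarrow> 'a set \<Rightarrow> bool" where
  "saturated_in X S \<longleftrightarrow> S \<subseteq> topspace X \<and> S = \<Inter>{U. openin X U \<and> S \<subseteq> U}"

definition compact_saturated :: "'a topology \<Rightarrow> 'a set set" where
  "compact_saturated X = {K. K \<noteq> {} \<and> compactin X K \<and> saturated_in X K}"

definition filtered_family :: "'a set set \<Rightarrow> bool" where
  "filtered_family \<K> \<longleftrightarrow> \<K> \<noteq> {} \<and> (\<forall>A\<in>\<K>. \<forall>B\<in>\<K>. \<exists>C\<in>\<K>. C \<subseteq> A \<and> C \<subseteq> B)"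

definition well_filtered_space :: "'a topology \<Rightarrow> bool" where
  "well_filtered_space X \<longleftrightarrow> t0_space X \<and>
     (\<forall>\<K> U. \<K> \<subseteq> compact_saturated X \<and> filtered_family \<K> \<and> openin X U \<and> \<Inter>\<K> \<subseteq> U
        \<longrightarrow> (\<exists>K\<in>\<K>. K \<subseteq> U))"

definition coherent_space :: "'a topology \<Rightarrow> bool" where
  "coherent_space X \<longleftrightarrow> t0_space X \<and>
     (\<forall>A B. compactin X A \<and> saturated_in X A \<and> compactin X B \<and> saturated_in X B
        \<longrightarrow> compactin X (A \<inter> B))"

definition strongly_well_filtered_space :: "'a topology \<Rightarrow> bool" where
  "strongly_well_filtered_space X \<longleftrightarrow> t0_space X \<and>
     (\<forall>\<K> K U. \<K> \<subseteq> compact_saturated X \<and> filtered_family \<K> \<and> K \<in> compact_saturated X \<and>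
        openin X U \<and> \<Inter>\<K> \<inter> K \<subseteq> U
        \<longrightarrow> (\<exists>A\<in>\<K>. A \<inter> K \<subseteq> U))"

definition strong_R_space :: "'a topology \<Rightarrow> bool" where
  "strong_R_space X \<longleftrightarrow> t0_space X \<and>
     (\<forall>\<K> U. \<K> \<subseteq> compact_saturated X \<and> \<K> \<noteq> {} \<and> openin X U \<and> \<Inter>\<K> \<subseteq> U
        \<longrightarrow> (\<exists>\<J>. \<J> \<subseteq> \<K> \<and> \<J> \<noteq> {} \<and> finite \<J> \<and> \<Inter>\<J> \<subseteq> U))"

definition directed_in :: "('a, 'b) gorder_scheme \<Rightarrow> 'a set \<Rightarrow> bool" where
  "directed_in L D \<longleftrightarrow> D \<subseteq> carrier L \<and> D \<noteq> {} \<and>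
     (\<forall>x\<in>D. \<forall>y\<in>D. \<exists>z\<in>D. x \<sqsubseteq>\<^bsub>L\<^esub> z \<and> y \<sqsubseteq>\<^bsub>L\<^esub> z)"

definition scott_open :: "('a, 'b) gorder_scheme \<Rightarrow> 'a set \<Rightarrow> bool" where
  "scott_open L U \<longleftrightarrow> U \<subseteq> carrier L \<and>
     (\<forall>x\<in>U. \<forall>y\<in>carrier L. x \<sqsubseteq>\<^bsub>L\<^esub> y \<longrightarrow> y \<in> U) \<and>
     (\<forall>D s. directed_in L D \<and> is_lub L s D \<and> s \<in> U \<longrightarrow> D \<inter> U \<noteq> {})"

definition scott_topology :: "('a, 'b) gorder_scheme \<Rightarrow> 'a topology" where
  "scott_topology L = topology (scott_open L)"

lemma istopology_scott_open: "istopology (scott_open L)"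
  unfolding istopology_def
proof (intro conjI allI impI)
  fix S T assume S: "scott_open L S" and T: "scott_open L T"
  show "scott_open L (S \<inter> T)"
    unfolding scott_open_def
  proof (intro conjI allI impI)
    show "S \<inter> T \<subseteq> carrier L" using S by (auto simp: scott_open_def)
    show "\<forall>x\<in>S \<inter> T. \<forall>y\<in>carrier L. x \<sqsubseteq>\<^bsub>L\<^esub> y \<longrightarrow> y \<in> S \<inter> T"
      using S T by (auto simp: scott_open_def)
    fix D s assume D: "directed_in L D \<and> is_lub L s D \<and> s \<in> S \<inter> T"
    then have "D \<inter> S \<noteq> {}" using S unfolding scott_open_def by auto
    moreover have "D \<inter> T \<noteq> {}" using D T unfolding scott_open_def by auto
    ultimately obtain a b where ab: "a \<in> D" "a \<in> S" "b \<in> D" "b \<in> T" by blast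
    then obtain c where c: "c \<in> D" "a \<sqsubseteq>\<^bsub>L\<^esub> c" "b \<sqsubseteq>\<^bsub>L\<^esub> c"
      using D unfolding directed_in_def by blast
    then have "c \<in> carrier L" using D unfolding directed_in_def by blast
    then have "c \<in> S" "c \<in> T" using S T ab c by (simp_all add: scott_open_def)
    then show "D \<inter> (S \<inter> T) \<noteq> {}" using c by blast
  qed
next
  fix \<K> assume "\<forall>K\<in>\<K>. scott_open L K"
  then show "scott_open L (\<Union>\<K>)"
    unfolding scott_open_def
  proof (intro conjI allI impI)
    fix D s
    assume \<K>: "\<forall>K\<in>\<K>. K \<subseteq> carrier L \<and> (\<forall>x\<in>K. \<forall>y\<in>carrier L. x \<sqsubseteq>\<^bsub>L\<^esub> y \<longrightarrow> y \<in> K) \<and>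
        (\<forall>D s. directed_in L D \<and> is_lub L s D \<and> s \<in> K \<longrightarrow> D \<inter> K \<noteq> {})"
      and D: "directed_in L D \<and> is_lub L s D \<and> s \<in> \<Union>\<K>"
    then obtain K where K: "K \<in> \<K>" "s \<in> K" by auto
    with \<K> D have "D \<inter> K \<noteq> {}" by metis
    with K show "D \<inter> \<Union>\<K> \<noteq> {}" by auto
  qed auto
qed

lemma openin_scott_topology: "openin (scott_topology L) U \<longleftrightarrow> scott_open L U"
  by (simp add: scott_topology_def istopology_scott_open)

lemma topspace_scott_topology: "topspace (scott_topology L) = carrier L"
proof -
  have "scott_open L (carrier L)"
    by (auto simp: scott_open_def directed_in_def)
  then show ?thesis
    unfolding topspace_def openin_scott_topology by (auto simp: scott_open_def)
qed

definition smyth_order :: "'a topology \<Rightarrow> 'a set gorder" where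
  "smyth_order X = \<lparr>carrier = compact_saturated X, eq = (=), le = (\<lambda>K\<^sub>1 K\<^sub>2. K\<^sub>2 \<subseteq> K\<^sub>1)\<rparr>"

lemma partial_order_smyth_order: "partial_order (smyth_order X)"
  by unfold_locales (auto simp: smyth_order_def)

definition scott_power_space :: "'a topology \<Rightarrow> 'a set topology" where
  "scott_power_space X = scott_topology (smyth_order X)"

end

theory Submission
  imports Defs
begin

text \<open>
  In a coherent well-filtered space, filtered intersections and nonempty binary intersections of
  members of \<open>Q(X)\<close> belong to \<open>Q(X)\<close>, so \<open>Q(X)\<close> is a dcpo in which every pair with an upper bound
  has a supremum. In such a poset the lower set generated by \<open>A \<inter> K\<close> is Scott closed whenever
  \<open>A\<close> is Scott closed and \<open>K\<close> is a compact upper set. Well-filteredness follows as in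
  the work of Xi and Lawson: a minimal closed set \<open>A\<close> that meets all members of a filtered family is
  the lower set generated by \<open>A \<inter> K\<close> for each member \<open>K\<close>, so each maximal element of \<open>A\<close>
  lies in every \<open>K\<close>. For coherence, the points \<open>a\<close> such that the part of \<open>B\<close> above \<open>a\<close> is contained
  in a given open set form an open set, which lets a cover of \<open>A \<inter> B\<close> be reduced
  to a finite one by compactness of \<open>A\<close>.
\<close>

section \<open>Intersections of compact saturated sets\<close>

lemma saturated_in_iff:
  "saturated_in X S \<longleftrightarrow>
    S \<subseteq> topspace X \<and> (\<forall>x. (\<forall>U. openin X U \<longrightarrow> S \<subseteq> U \<longrightarrow> x \<in> U) \<longrightarrow> x \<in> S)"
proof -
  have "S = \<Inter>{U. openin X U \<and> S \<subseteq> U} \<longleftrightarrow> \<Inter>{U. openin X U \<and> S \<subseteq> U} \<subseteq> S"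
    by blast
  then show ?thesis
    unfolding saturated_in_def by (simp add: subset_iff imp_conjL)
qed

lemma saturated_in_Inter:
  assumes "\<K> \<noteq> {}" "\<And>K. K \<in> \<K> \<Longrightarrow> saturated_in X K"
  shows "saturated_in X (\<Inter>\<K>)"
  unfolding saturated_in_iff
proof (intro conjI allI impI)
  show "\<Inter>\<K> \<subseteq> topspace X"
    using assms by (auto simp: saturated_in_def)
  show "x \<in> \<Inter>\<K>" if x: "\<forall>U. openin X U \<longrightarrow> \<Inter>\<K> \<subseteq> U \<longrightarrow> x \<in> U" for x
  proof
    fix K assume K: "K \<in> \<K>"
    then have "\<forall>U. openin X U \<longrightarrow> K \<subseteq> U \<longrightarrow> x \<in> U"
      using x by blast
    then show "x \<in> K"
      using assms(2)[OF K] unfolding saturated_in_iff by blast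
  qed
qed

text \<open>Coherence treats two sets at a time; the induction goes through because the intersection
  over \<open>\<F>\<close> is again saturated.\<close>

lemma coherent_space_compactin_Inter:
  assumes "coherent_space X" "finite \<F>" "\<F> \<noteq> {}"
    and "\<And>K. K \<in> \<F> \<Longrightarrow> compactin X K \<and> saturated_in X K"
  shows "compactin X (\<Inter>\<F>)"
  using assms(2-)
proof (induction \<F> rule: finite_ne_induct)
  case (insert K \<F>)
  then have "saturated_in X (\<Inter>\<F>)"
    by (intro saturated_in_Inter) auto
  with insert assms(1) show ?case
    unfolding coherent_space_def by simp
qed simp

lemma filtered_family_finite_lower_bound:
  assumes "filtered_family \<K>" "finite \<F>" "\<F> \<subseteq> \<K>"
  shows "\<exists>A\<in>\<K>. A \<subseteq> \<Inter>\<F>"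
  using assms(2,3)
proof (induction \<F> rule: finite_induct)
  case empty
  then show ?case using assms(1) by (auto simp: filtered_family_def)
next
  case (insert K \<F>)
  then obtain A where "A \<in> \<K>" "A \<subseteq> \<Inter>\<F>" by auto
  with insert.prems assms(1) obtain C where "C \<in> \<K>" "C \<subseteq> A" "C \<subseteq> K"
    unfolding filtered_family_def by (metis insert_subset)
  with \<open>A \<subseteq> \<Inter>\<F>\<close> show ?case by auto
qed

section \<open>Strong R-spaces and strong well-filteredness\<close>

text \<open>If some finite intersection of members is empty, it already lies in \<open>U\<close>.
  Otherwise the finite intersections are compact by coherence and form a filtered family in Q(X)
  whose intersection lies in that of \<open>\<K>\<close>, so well-filteredness applies to
  them.\<close>

lemma coherent_well_filtered_imp_strong_R_space:
  assumes coh: "coherent_space X" and wf: "well_filtered_space X"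
  shows "strong_R_space X"
  unfolding strong_R_space_def
proof (intro conjI allI impI)
  show "t0_space X" using coh by (simp add: coherent_space_def)
  fix \<K> U
  assume asm: "\<K> \<subseteq> compact_saturated X \<and> \<K> \<noteq> {} \<and> openin X U \<and> \<Inter>\<K> \<subseteq> U"
  let ?S = "{\<J>. \<J> \<subseteq> \<K> \<and> \<J> \<noteq> {} \<and> finite \<J>}"
  show "\<exists>\<J>. \<J> \<subseteq> \<K> \<and> \<J> \<noteq> {} \<and> finite \<J> \<and> \<Inter>\<J> \<subseteq> U"
  proof (cases "\<exists>\<J>\<in>?S. \<Inter>\<J> = {}")
    case True
    then obtain \<J> where "\<J> \<in> ?S" "\<Inter>\<J> = {}" by blast
    then show ?thesis by (intro exI[of _ \<J>]) auto
  next
    case False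
    let ?I = "Inter ` ?S"
    have "?I \<subseteq> compact_saturated X"
    proof clarify
      fix \<J> assume J: "\<J> \<subseteq> \<K>" "\<J> \<noteq> {}" "finite \<J>"
      then have *: "compactin X K \<and> saturated_in X K" if "K \<in> \<J>" for K
        using that asm by (auto simp: compact_saturated_def)
      then have "compactin X (\<Inter>\<J>)" "saturated_in X (\<Inter>\<J>)"
        using J coherent_space_compactin_Inter[OF coh] saturated_in_Inter by blast+
      with False J show "\<Inter>\<J> \<in> compact_saturated X"
        by (auto simp: compact_saturated_def)
    qed
    moreover have "filtered_family ?I"
      unfolding filtered_family_def
    proof (intro conjI ballI)
      obtain K where "K \<in> \<K>" using asm by blast
      then have "{K} \<in> ?S" by simp
      then show "?I \<noteq> {}" by blast
      fix A B assume "A \<in> ?I" "B \<in> ?I"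
      then obtain F G where "F \<in> ?S" "A = \<Inter>F" "G \<in> ?S" "B = \<Inter>G" by blast
      then show "\<exists>C\<in>?I. C \<subseteq> A \<and> C \<subseteq> B"
        by (intro bexI[of _ "\<Inter>(F \<union> G)"] imageI) auto
    qed
    moreover have "\<Inter>?I \<subseteq> \<Inter>\<K>"
    proof
      fix x assume x: "x \<in> \<Inter>?I"
      have "x \<in> K" if "K \<in> \<K>" for K
      proof -
        have "\<Inter>{K} \<in> ?I" using that by (intro imageI) auto
        then show ?thesis using x by auto
      qed
      then show "x \<in> \<Inter>\<K>" by blast
    qed
    ultimately have "\<exists>K\<in>?I. K \<subseteq> U"
      using wf asm unfolding well_filtered_space_def by (meson subset_trans)
    then show ?thesis by blast
  qed
qed

text \<open>The strong R-property is applied to the family enlarged by \<open>K\<close>;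
  filteredness then merges the finitely many selected members into one.\<close>

lemma strong_R_imp_strongly_well_filtered_space:
  assumes "strong_R_space X"
  shows "strongly_well_filtered_space X"
  unfolding strongly_well_filtered_space_def
proof (intro conjI allI impI)
  show "t0_space X" using assms by (simp add: strong_R_space_def)
  fix \<K> K U
  assume asm: "\<K> \<subseteq> compact_saturated X \<and> filtered_family \<K> \<and> K \<in> compact_saturated X \<and>
    openin X U \<and> \<Inter>\<K> \<inter> K \<subseteq> U"
  then have "insert K \<K> \<subseteq> compact_saturated X" "\<Inter>(insert K \<K>) \<subseteq> U" "openin X U" by auto
  then obtain \<J> where J: "\<J> \<subseteq> insert K \<K>" "finite \<J>" "\<Inter>\<J> \<subseteq> U"
    using assms unfolding strong_R_space_def by (metis insert_not_empty)
  \<comment> \<open>This set may be empty, in which case the lower bound lemma just returns some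
    member of \<open>\<K>\<close>.\<close>
  then have "finite (\<J> - {K})" "\<J> - {K} \<subseteq> \<K>" by auto
  with asm obtain A where "A \<in> \<K>" "A \<subseteq> \<Inter>(\<J> - {K})"
    using filtered_family_finite_lower_bound by metis
  then have "A \<inter> K \<subseteq> \<Inter>\<J>" by auto
  with J \<open>A \<in> \<K>\<close> show "\<exists>A\<in>\<K>. A \<inter> K \<subseteq> U" by blast
qed

text \<open>A nonempty finite subcover taken from a chain contains its own union. This supplies the
  chain condition when Zorn's lemma is applied to open sets.\<close>

lemma compactin_subset_Union_chain:
  assumes "compactin X K" "subset.chain \<A> \<C>" "\<C> \<noteq> {}"
    and "\<And>U. U \<in> \<C> \<Longrightarrow> openin X U" "K \<subseteq> \<Union>\<C>"
  shows "\<exists>U\<in>\<C>. K \<subseteq> U"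
proof -
  obtain \<F> where F: "finite \<F>" "\<F> \<subseteq> \<C>" "K \<subseteq> \<Union>\<F>"
    using assms unfolding compactin_def by meson
  show ?thesis
  proof (cases "\<F> = {}")
    case True
    then show ?thesis using F assms(3) by auto
  next
    case False
    have "subset.chain \<A> \<F>"
      using assms(2) F(2) unfolding subset_chain_def by (meson subsetD subset_trans)
    then show ?thesis
      using Union_in_chain[OF F(1) False] F by blast
  qed
qed

section \<open>Scott closed sets in a dcpo with bounded binary suprema\<close>

text \<open>This isolates the order properties of Q(X) on which the topological arguments rest.
  Suprema are demanded only for pairs with an upper bound, since two members of Q(X) with empty
  intersection have no upper bound in the Smyth order.\<close>

locale bounded_complete_dcpo = partial_order L for L (structure) +
  assumes directed_has_lub: "directed_in L D \<Longrightarrow> \<exists>s. is_lub L s D"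
    and bounded_pair_has_lub:
      "\<lbrakk>x \<in> carrier L; y \<in> carrier L; z \<in> carrier L; x \<sqsubseteq> z; y \<sqsubseteq> z\<rbrakk> \<Longrightarrow> \<exists>s. is_lub L s {x, y}"
begin

lemma is_lub_iff:
  assumes "D \<subseteq> carrier L"
  shows "is_lub L s D \<longleftrightarrow> s \<in> carrier L \<and> (\<forall>d\<in>D. d \<sqsubseteq> s) \<and>
    (\<forall>u\<in>carrier L. (\<forall>d\<in>D. d \<sqsubseteq> u) \<longrightarrow> s \<sqsubseteq> u)"
proof -
  have "x \<in> Upper L D \<longleftrightarrow> x \<in> carrier L \<and> (\<forall>d\<in>D. d \<sqsubseteq> x)" for x
    using assms by (auto simp: Upper_def)
  then show ?thesis unfolding least_def by auto
qed

lemma closedin_scott_topology: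
  "closedin (scott_topology L) A \<longleftrightarrow> A \<subseteq> carrier L \<and>
    (\<forall>a\<in>A. \<forall>x\<in>carrier L. x \<sqsubseteq> a \<longrightarrow> x \<in> A) \<and>
    (\<forall>D s. directed_in L D \<and> is_lub L s D \<and> D \<subseteq> A \<longrightarrow> s \<in> A)"
  (is "?closed \<longleftrightarrow> ?sub \<and> ?low \<and> ?lubs")
proof -
  have lub: "s \<in> carrier L" "D \<subseteq> carrier L" if "directed_in L D" "is_lub L s D" for D s
    using that by (auto simp: directed_in_def least_def Upper_def)
  have "?sub \<longrightarrow>
      (?low \<longleftrightarrow> (\<forall>x\<in>carrier L - A. \<forall>y\<in>carrier L. x \<sqsubseteq> y \<longrightarrow> y \<in> carrier L - A))"
    (is "_ \<longrightarrow> (_ \<longleftrightarrow> ?up)")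
    by blast
  moreover have "?lubs \<longleftrightarrow> (\<forall>D s. directed_in L D \<and> is_lub L s D \<and> s \<in> carrier L - A
      \<longrightarrow> D \<inter> (carrier L - A) \<noteq> {})"
    (is "_ \<longleftrightarrow> ?inacc")
  proof -
    have "(D \<subseteq> A \<longrightarrow> s \<in> A) \<longleftrightarrow> (s \<in> carrier L - A \<longrightarrow> D \<inter> (carrier L - A) \<noteq> {})"
      if "directed_in L D" "is_lub L s D" for D s
      using lub[OF that] by blast
    then show ?thesis by metis
  qed
  moreover have "?closed \<longleftrightarrow> ?sub \<and> ?up \<and> ?inacc"
    unfolding closedin_def topspace_scott_topology openin_scott_topology scott_open_def
    by (simp only: Diff_subset simp_thms)
  ultimately show ?thesis by argo
qed

lemma closedin_principal_down:
  assumes "x \<in> carrier L"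
  shows "closedin (scott_topology L) {y \<in> carrier L. y \<sqsubseteq> x}"
  unfolding closedin_scott_topology
proof (intro conjI allI impI)
  show "\<forall>a\<in>{y \<in> carrier L. y \<sqsubseteq> x}. \<forall>z\<in>carrier L. z \<sqsubseteq> a \<longrightarrow> z \<in> {y \<in> carrier L. y \<sqsubseteq> x}"
    using assms le_trans by blast
  show "s \<in> {y \<in> carrier L. y \<sqsubseteq> x}"
    if "directed_in L D \<and> is_lub L s D \<and> D \<subseteq> {y \<in> carrier L. y \<sqsubseteq> x}" for D s
  proof -
    have "D \<subseteq> carrier L" using that by auto
    from that is_lub_iff[OF this] assms show ?thesis by auto
  qed
qed auto

text \<open>Distinct points cannot lie below each other by antisymmetry, and the complement of a
  principal lower set is an open set realizing the failing inequality.\<close>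

lemma t0_space_scott_topology: "t0_space (scott_topology L)"
proof -
  have "\<exists>U. openin (scott_topology L) U \<and> (x \<notin> U \<longleftrightarrow> y \<in> U)"
    if xy: "x \<in> carrier L" "y \<in> carrier L" "x \<noteq> y" for x y
  proof -
    have sep: "\<exists>U. openin (scott_topology L) U \<and> v \<notin> U \<and> u \<in> U"
      if "u \<in> carrier L" "v \<in> carrier L" "\<not> u \<sqsubseteq> v" for u v
      using closedin_principal_down[of v] that
      by (intro exI[of _ "carrier L - {y \<in> carrier L. y \<sqsubseteq> v}"])
        (auto simp: closedin_def topspace_scott_topology)
    consider "\<not> x \<sqsubseteq> y" | "\<not> y \<sqsubseteq> x"
      using xy le_antisym by (auto simp: eq_is_equal)
    then show ?thesis
      using sep xy by cases blast+
  qed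
  then show ?thesis
    unfolding t0_space_def topspace_scott_topology by blast
qed

lemma saturated_in_scott_topology_upper:
  assumes "saturated_in (scott_topology L) K" "x \<in> K" "y \<in> carrier L" "x \<sqsubseteq> y"
  shows "y \<in> K"
proof -
  have "y \<in> U" if U: "openin (scott_topology L) U" "K \<subseteq> U" for U
  proof -
    have "x \<in> U" using assms(2) U(2) by blast
    moreover have "\<forall>x\<in>U. \<forall>y\<in>carrier L. x \<sqsubseteq> y \<longrightarrow> y \<in> U"
      using U(1) by (simp add: openin_scott_topology scott_open_def)
    ultimately show ?thesis using assms(3,4) by blast
  qed
  with assms(1) show ?thesis unfolding saturated_in_iff by blast
qed

text \<open>One bound replaces the separate bounds for each \<open>d\<close>. The suprema
  \<open>j d\<close> of \<open>k\<close> and \<open>d\<close> exist because these pairs are bounded;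
  they lie in the lower set \<open>A\<close> and form a directed family, so their supremum belongs
  to the closed set \<open>A\<close>.\<close>

lemma closedin_common_upper_bound:
  assumes A: "closedin (scott_topology L) A" and D: "directed_in L D" and k: "k \<in> carrier L"
    and bd: "\<And>d. d \<in> D \<Longrightarrow> \<exists>a\<in>A. k \<sqsubseteq> a \<and> d \<sqsubseteq> a"
  shows "\<exists>a\<in>A. k \<sqsubseteq> a \<and> (\<forall>d\<in>D. d \<sqsubseteq> a)"
proof -
  have DL: "D \<subseteq> carrier L" and AL: "A \<subseteq> carrier L"
    using D A by (auto simp: directed_in_def closedin_scott_topology)
  have "\<exists>s. is_lub L s {k, d}" if "d \<in> D" for d
    using bd[OF that] bounded_pair_has_lub k that DL AL by blast
  then obtain j where j: "\<And>d. d \<in> D \<Longrightarrow> is_lub L (j d) {k, d}" by metis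
  have jL: "j d \<in> carrier L" and kj: "k \<sqsubseteq> j d" and dj: "d \<sqsubseteq> j d"
    and jle: "\<And>u. u \<in> carrier L \<Longrightarrow> k \<sqsubseteq> u \<Longrightarrow> d \<sqsubseteq> u \<Longrightarrow> j d \<sqsubseteq> u" if "d \<in> D" for d
  proof -
    have "{k, d} \<subseteq> carrier L" using k that DL by auto
    from j[OF that] is_lub_iff[OF this]
    show "j d \<in> carrier L" "k \<sqsubseteq> j d" "d \<sqsubseteq> j d"
      "\<And>u. u \<in> carrier L \<Longrightarrow> k \<sqsubseteq> u \<Longrightarrow> d \<sqsubseteq> u \<Longrightarrow> j d \<sqsubseteq> u"
      by auto
  qed
  have jA: "j ` D \<subseteq> A"
  proof clarify
    fix d assume d: "d \<in> D"
    then obtain a where "a \<in> A" "k \<sqsubseteq> a" "d \<sqsubseteq> a" using bd by blast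
    then show "j d \<in> A"
      using jle[OF d] jL[OF d] A AL unfolding closedin_scott_topology by blast
  qed
  have jdir: "directed_in L (j ` D)"
    unfolding directed_in_def
  proof (intro conjI ballI)
    show "j ` D \<subseteq> carrier L" using jL by auto
    show "j ` D \<noteq> {}" using D by (auto simp: directed_in_def)
    fix p q assume "p \<in> j ` D" "q \<in> j ` D"
    then obtain d e where de: "d \<in> D" "p = j d" "e \<in> D" "q = j e" by blast
    then obtain f where f: "f \<in> D" "d \<sqsubseteq> f" "e \<sqsubseteq> f"
      using D unfolding directed_in_def by blast
    have "j d \<sqsubseteq> j f" "j e \<sqsubseteq> j f"
      using jle jL kj dj de f DL le_trans by (meson subsetD)+
    then show "\<exists>z\<in>j ` D. p \<sqsubseteq> z \<and> q \<sqsubseteq> z" using de f by blast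
  qed
  then obtain s where s: "is_lub L s (j ` D)" using directed_has_lub by blast
  have "j ` D \<subseteq> carrier L" using jL by auto
  then have sL: "s \<in> carrier L" and js: "\<And>d. d \<in> D \<Longrightarrow> j d \<sqsubseteq> s"
    using s by (auto simp: is_lub_iff)
  have "s \<in> A" using A jdir s jA unfolding closedin_scott_topology by blast
  moreover have "d \<sqsubseteq> s" "k \<sqsubseteq> s" if "d \<in> D" for d
    using js[OF that] dj[OF that] kj[OF that] jL[OF that] sL k that DL le_trans by blast+
  moreover have "D \<noteq> {}" using D by (simp add: directed_in_def)
  ultimately show ?thesis by blast
qed

lemma directed_in_finite_upper_bound:
  assumes "directed_in L D" "finite F" "F \<subseteq> D"
  shows "\<exists>z\<in>D. \<forall>x\<in>F. x \<sqsubseteq> z"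
  using assms(2,3)
proof (induction F rule: finite_induct)
  case empty
  have "D \<noteq> {}" using assms(1) by (simp add: directed_in_def)
  then show ?case by auto
next
  case (insert x F)
  then obtain z where z: "z \<in> D" "\<forall>x\<in>F. x \<sqsubseteq> z" by auto
  with insert.prems assms(1) obtain w where w: "w \<in> D" "x \<sqsubseteq> w" "z \<sqsubseteq> w"
    unfolding directed_in_def by (meson insert_subset)
  have DL: "D \<subseteq> carrier L" using assms(1) by (simp add: directed_in_def)
  have "y \<sqsubseteq> w" if "y \<in> F" for y
  proof -
    have "y \<in> carrier L" "z \<in> carrier L" "w \<in> carrier L" "y \<sqsubseteq> z"
      using that z w insert.prems DL by auto
    with w show ?thesis using le_trans by blast
  qed
  with w show ?case by blast
qed

definition down_set :: "'a set \<Rightarrow> 'a set" where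
  "down_set S = {x \<in> carrier L. \<exists>y\<in>S. x \<sqsubseteq> y}"

text \<open>A directed subset of the lower set has, together with \<open>x\<close>, a common upper
  bound in \<open>A\<close>; its supremum lies below that bound. These sets serve as the closed sets
  in the compactness argument for general \<open>K\<close>.\<close>

lemma closedin_down_set_Int_principal_up:
  assumes A: "closedin (scott_topology L) A" and x: "x \<in> carrier L"
  shows "closedin (scott_topology L) (down_set (A \<inter> {y. x \<sqsubseteq> y}))"
  unfolding closedin_scott_topology
proof (intro conjI allI impI)
  let ?B = "down_set (A \<inter> {y. x \<sqsubseteq> y})"
  have AL: "A \<subseteq> carrier L" using A by (simp add: closedin_scott_topology)
  show "?B \<subseteq> carrier L" by (auto simp: down_set_def)
  show "\<forall>a\<in>?B. \<forall>z\<in>carrier L. z \<sqsubseteq> a \<longrightarrow> z \<in> ?B"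
    unfolding down_set_def using AL le_trans by blast
  fix D s assume asm: "directed_in L D \<and> is_lub L s D \<and> D \<subseteq> ?B"
  then have "\<exists>a\<in>A. x \<sqsubseteq> a \<and> d \<sqsubseteq> a" if "d \<in> D" for d
    using that unfolding down_set_def by blast
  then obtain a where a: "a \<in> A" "x \<sqsubseteq> a" "\<forall>d\<in>D. d \<sqsubseteq> a"
    using closedin_common_upper_bound[OF A _ x] asm by blast
  have DL: "D \<subseteq> carrier L" using asm by (simp add: directed_in_def)
  have "s \<in> carrier L" "s \<sqsubseteq> a"
    using asm a AL unfolding is_lub_iff[OF DL] by auto
  with a show "s \<in> ?B" unfolding down_set_def by blast
qed

text \<open>Compactness of \<open>K\<close> yields a single \<open>k\<close> that has, with each
  \<open>d\<close> of the directed set, an upper bound in \<open>A\<close>. A common bound in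
  \<open>A\<close> then lies above \<open>k\<close>, hence in \<open>K\<close>, and dominates the
  supremum.\<close>

lemma closedin_down_set_Int_compactin:
  assumes A: "closedin (scott_topology L) A" and K: "compactin (scott_topology L) K"
    and up: "\<And>x y. x \<in> K \<Longrightarrow> y \<in> carrier L \<Longrightarrow> x \<sqsubseteq> y \<Longrightarrow> y \<in> K"
  shows "closedin (scott_topology L) (down_set (A \<inter> K))"
  unfolding closedin_scott_topology
proof (intro conjI allI impI)
  have AL: "A \<subseteq> carrier L" using A by (simp add: closedin_scott_topology)
  have KL: "K \<subseteq> carrier L" using K by (simp add: compactin_def topspace_scott_topology)
  show "down_set (A \<inter> K) \<subseteq> carrier L" by (auto simp: down_set_def)
  show "\<forall>a\<in>down_set (A \<inter> K). \<forall>z\<in>carrier L. z \<sqsubseteq> a \<longrightarrow> z \<in> down_set (A \<inter> K)"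
    unfolding down_set_def using AL le_trans by blast
  fix D s assume asm: "directed_in L D \<and> is_lub L s D \<and> D \<subseteq> down_set (A \<inter> K)"
  then have DL: "D \<subseteq> carrier L" by (simp add: directed_in_def)
  let ?C = "\<lambda>d. down_set (A \<inter> {y. d \<sqsubseteq> y})"
  \<comment> \<open>Finite intersection property: a member \<open>z\<close> of \<open>D\<close>
    above the finitely many indices lies below some point of \<open>A \<inter> K\<close>, and that
    point belongs to all the chosen sets.\<close>
  have "K \<inter> \<Inter>\<F> \<noteq> {}" if F: "finite \<F>" "\<F> \<subseteq> ?C ` D" for \<F>
  proof -
    obtain F where F': "F \<subseteq> D" "finite F" "\<F> = ?C ` F"
      using F finite_subset_image by metis
    then obtain z where z: "z \<in> D" "\<forall>x\<in>F. x \<sqsubseteq> z"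
      using directed_in_finite_upper_bound asm by blast
    then obtain a where a: "a \<in> A" "a \<in> K" "z \<sqsubseteq> a"
      using asm unfolding down_set_def by blast
    have "a \<in> ?C x" if "x \<in> F" for x
    proof -
      have "x \<in> carrier L" "z \<in> carrier L" "a \<in> carrier L" "x \<sqsubseteq> z"
        using that F' z a DL AL by auto
      then have "x \<sqsubseteq> a" using a le_trans by blast
      then show ?thesis using a \<open>a \<in> carrier L\<close> unfolding down_set_def by auto
    qed
    then show ?thesis using a F' by blast
  qed
  moreover have "\<forall>C\<in>?C ` D. closedin (scott_topology L) C"
    using closedin_down_set_Int_principal_up[OF A] DL by blast
  ultimately have "K \<inter> \<Inter>(?C ` D) \<noteq> {}"
    using K unfolding compactin_fip by blast
  then obtain k where k: "k \<in> K" "\<And>d. d \<in> D \<Longrightarrow> k \<in> ?C d" by blast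
  then have "\<exists>a\<in>A. k \<sqsubseteq> a \<and> d \<sqsubseteq> a" if "d \<in> D" for d
    using that unfolding down_set_def by blast
  then obtain a where a: "a \<in> A" "k \<sqsubseteq> a" "\<forall>d\<in>D. d \<sqsubseteq> a"
    using closedin_common_upper_bound[OF A, of D k] asm k KL by blast
  then have "a \<in> K" using up k AL by blast
  moreover have "s \<in> carrier L" "s \<sqsubseteq> a"
    using asm a AL unfolding is_lub_iff[OF DL] by auto
  ultimately show "s \<in> down_set (A \<inter> K)"
    using a unfolding down_set_def by blast
qed

text \<open>Zorn's lemma: a nonempty chain is directed, and its supremum stays in the closed
  set.\<close>

lemma closedin_has_maximal:
  assumes A: "closedin (scott_topology L) A" and ne: "A \<noteq> {}"
  shows "\<exists>m\<in>A. \<forall>a\<in>A. m \<sqsubseteq> a \<longrightarrow> a = m"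
proof (rule predicate_Zorn)
  have AL: "A \<subseteq> carrier L" using A by (simp add: closedin_scott_topology)
  show "partial_order_on A (relation_of (\<sqsubseteq>) A)"
  proof (rule partial_order_on_relation_ofI)
    show "x \<sqsubseteq> x" if "x \<in> A" for x using that AL by auto
    show "x \<sqsubseteq> z" if "x \<in> A" "y \<in> A" "z \<in> A" "x \<sqsubseteq> y" "y \<sqsubseteq> z" for x y z
      using that AL le_trans[of x y z] by auto
    show "x = y" if "x \<in> A" "y \<in> A" "x \<sqsubseteq> y" "y \<sqsubseteq> x" for x y
      using that AL le_antisym[of x y] by (auto simp: eq_is_equal)
  qed
  fix C assume C: "C \<in> Chains (relation_of (\<sqsubseteq>) A)"
  then have CA: "C \<subseteq> A" and lin: "\<And>x y. x \<in> C \<Longrightarrow> y \<in> C \<Longrightarrow> x \<sqsubseteq> y \<or> y \<sqsubseteq> x"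
    unfolding Chains_def relation_of_def by blast+
  show "\<exists>u\<in>A. \<forall>a\<in>C. a \<sqsubseteq> u"
  proof (cases "C = {}")
    case True
    then show ?thesis using ne by blast
  next
    case False
    have "\<exists>z\<in>C. x \<sqsubseteq> z \<and> y \<sqsubseteq> z" if "x \<in> C" "y \<in> C" for x y
      using lin[OF that] that CA AL by (meson le_refl subsetD)
    then have dir: "directed_in L C"
      using False CA AL unfolding directed_in_def by blast
    then obtain s where s: "is_lub L s C" using directed_has_lub by blast
    then have "s \<in> A" using A dir CA unfolding closedin_scott_topology by blast
    moreover have "\<forall>a\<in>C. a \<sqsubseteq> s" using s is_lub_iff[of C] CA AL by blast
    ultimately show ?thesis by blast
  qed
qed

section \<open>Well-filteredness of the Scott topology\<close>

lemma well_filtered_space_scott_topology: "well_filtered_space (scott_topology L)"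
  unfolding well_filtered_space_def
proof (intro conjI allI impI t0_space_scott_topology)
  let ?X = "scott_topology L"
  fix \<K> U
  assume asm: "\<K> \<subseteq> compact_saturated ?X \<and> filtered_family \<K> \<and> openin ?X U \<and> \<Inter>\<K> \<subseteq> U"
  then have cpt: "compactin ?X K" and sat: "saturated_in ?X K" if "K \<in> \<K>" for K
    using that by (auto simp: compact_saturated_def)
  show "\<exists>K\<in>\<K>. K \<subseteq> U"
  proof (rule ccontr)
    assume neg: "\<not> ?thesis"
    \<comment> \<open>The minimal closed set is found through its complement: a maximal element
      \<open>M\<close> of this family is the complement of a minimal closed set that is disjoint
      from \<open>U\<close> and meets every member of \<open>\<K>\<close>.\<close>
    let ?\<A> = "{V. openin ?X V \<and> U \<subseteq> V \<and> (\<forall>K\<in>\<K>. \<not> K \<subseteq> V)}"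
    have "\<exists>M\<in>?\<A>. \<forall>V\<in>?\<A>. M \<subseteq> V \<longrightarrow> V = M"
    proof (rule subset_Zorn_nonempty)
      show "?\<A> \<noteq> {}" using asm neg by blast
      fix \<C> assume ne: "\<C> \<noteq> {}" and ch: "subset.chain ?\<A> \<C>"
      then have sub: "\<C> \<subseteq> ?\<A>" by (simp add: subset_chain_def)
      have "\<not> K \<subseteq> \<Union>\<C>" if "K \<in> \<K>" for K
        using compactin_subset_Union_chain[OF cpt[OF that] ch ne] sub that by blast
      with sub ne show "\<Union>\<C> \<in> ?\<A>" by (auto intro: openin_Union)
    qed
    then obtain M where M: "openin ?X M" "U \<subseteq> M" "\<And>K. K \<in> \<K> \<Longrightarrow> \<not> K \<subseteq> M"
      and max: "\<And>V. openin ?X V \<Longrightarrow> M \<subseteq> V \<Longrightarrow> (\<And>K. K \<in> \<K> \<Longrightarrow> \<not> K \<subseteq> V) \<Longrightarrow> V = M"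
      by (smt (verit) mem_Collect_eq subset_trans)
    define A where "A = carrier L - M"
    have A: "closedin ?X A"
      using M(1) unfolding A_def topspace_scott_topology[symmetric] by blast
    have KL: "K \<subseteq> carrier L" if "K \<in> \<K>" for K
      using cpt[OF that] by (simp add: compactin_def topspace_scott_topology)
    have meets: "A \<inter> K \<noteq> {}" if "K \<in> \<K>" for K
      using M(3)[OF that] KL[OF that] by (auto simp: A_def)
    have M_carrier: "M \<subseteq> carrier L" 
      using openin_subset[OF M(1)] by (simp add: topspace_scott_topology)
    \<comment> \<open>The lower set of \<open>A \<inter> K\<close> is closed, contained in
      \<open>A\<close>, and meets each \<open>K'\<close>: a member \<open>C\<close> inside both
      \<open>K\<close> and \<open>K'\<close> has a point in \<open>A\<close>. Minimality of
      \<open>A\<close>, in the form \<open>max\<close>, forces equality.\<close>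
    have A_sub: "A \<subseteq> down_set (A \<inter> K)" if K: "K \<in> \<K>" for K
    proof -
      let ?V = "carrier L - down_set (A \<inter> K)"
      have "closedin ?X (down_set (A \<inter> K))"
        using A cpt[OF K] saturated_in_scott_topology_upper[OF sat[OF K]]
        by (rule closedin_down_set_Int_compactin)
      then have "openin ?X ?V"
        unfolding topspace_scott_topology[symmetric] by blast
      moreover have "M \<subseteq> ?V"
      proof -
        have "down_set (A \<inter> K) \<subseteq> A"
          using A unfolding closedin_scott_topology down_set_def by blast
        then show ?thesis using M_carrier by (auto simp: A_def)
      qed
      moreover have "\<not> K' \<subseteq> ?V" if K': "K' \<in> \<K>" for K'
      proof -
        obtain C where C: "C \<in> \<K>" "C \<subseteq> K" "C \<subseteq> K'"
          using asm K K' unfolding filtered_family_def by blast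
        then obtain c where c: "c \<in> A" "c \<in> C" using meets by blast
        then have "c \<in> carrier L" using C KL by blast
        then have "c \<in> down_set (A \<inter> K)" using c C unfolding down_set_def by blast
        with c C show ?thesis by blast
      qed
      ultimately have "?V = M" by (rule max)
      then show ?thesis by (auto simp: A_def)
    qed
    obtain K0 where "K0 \<in> \<K>" using asm by (auto simp: filtered_family_def)
    then have "A \<noteq> {}" using meets by blast
    then obtain m where m: "m \<in> A" "\<And>a. a \<in> A \<Longrightarrow> m \<sqsubseteq> a \<Longrightarrow> a = m"
      using closedin_has_maximal[OF A] by blast
    \<comment> \<open>By \<open>A_sub\<close>, \<open>m\<close> lies below a point of
      \<open>A \<inter> K\<close>, which equals \<open>m\<close> by maximality.\<close>
    have "m \<in> K" if "K \<in> \<K>" for K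
      using A_sub[OF that] m unfolding down_set_def by blast
    then have "m \<in> U" using asm by blast
    with m(1) M(2) show False by (auto simp: A_def)
  qed
qed

section \<open>Coherence of the Scott topology\<close>

lemma compactin_principal_up:
  assumes "x \<in> carrier L"
  shows "compactin (scott_topology L) {y \<in> carrier L. x \<sqsubseteq> y}"
  unfolding compactin_def
proof (intro conjI allI impI)
  show "{y \<in> carrier L. x \<sqsubseteq> y} \<subseteq> topspace (scott_topology L)"
    by (auto simp: topspace_scott_topology)
  fix \<U>
  assume U: "Ball \<U> (openin (scott_topology L)) \<and> {y \<in> carrier L. x \<sqsubseteq> y} \<subseteq> \<Union>\<U>"
  then obtain V where "V \<in> \<U>" "x \<in> V" using assms by auto
  then show "\<exists>\<F>. finite \<F> \<and> \<F> \<subseteq> \<U> \<and> {y \<in> carrier L. x \<sqsubseteq> y} \<subseteq> \<Union>\<F>"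
    using U assms unfolding openin_scott_topology scott_open_def
    by (intro exI[of _ "{V}"]) auto
qed

text \<open>Two successive covering arguments: compactness of each
  \<open>{y \<in> carrier L. a \<sqsubseteq> y} \<inter> B\<close> gives a finite subcover depending
  on \<open>a\<close>, and compactness of \<open>A\<close> leaves only finitely many of these
  subcovers.\<close>

lemma compactin_Int_if_principal:
  assumes A: "compactin (scott_topology L) A" and B: "compactin (scott_topology L) B"
    and upA: "\<And>x y. x \<in> A \<Longrightarrow> y \<in> carrier L \<Longrightarrow> x \<sqsubseteq> y \<Longrightarrow> y \<in> A"
    and up: "\<And>x y. x \<in> B \<Longrightarrow> y \<in> carrier L \<Longrightarrow> x \<sqsubseteq> y \<Longrightarrow> y \<in> B"
    and prin: "\<And>a. a \<in> A \<Longrightarrow> compactin (scott_topology L) ({y \<in> carrier L. a \<sqsubseteq> y} \<inter> B)"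
  shows "compactin (scott_topology L) (A \<inter> B)"
  unfolding compactin_def
proof (intro conjI allI impI)
  let ?X = "scott_topology L"
  have AL: "A \<subseteq> carrier L" using A by (simp add: compactin_def topspace_scott_topology)
  then show "A \<inter> B \<subseteq> topspace ?X" by (auto simp: topspace_scott_topology)
  fix \<U> assume U: "Ball \<U> (openin ?X) \<and> A \<inter> B \<subseteq> \<Union>\<U>"
  \<comment> \<open>A point lies in \<open>W F\<close> exactly when every point of \<open>B\<close>
    above it is in \<open>\<Union>F\<close>. The set is open because the subtracted lower set is
    closed by compactness of \<open>B\<close>.\<close>
  define W where "W F = carrier L - down_set ((carrier L - \<Union>F) \<inter> B)" for F
  let ?S = "{F. finite F \<and> F \<subseteq> \<U>}"
  have "Ball (W ` ?S) (openin ?X)"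
  proof clarify
    fix F assume "F \<subseteq> \<U>"
    then have "openin ?X (\<Union>F)" using U by (intro openin_Union) auto
    then have "closedin ?X (carrier L - \<Union>F)"
      unfolding topspace_scott_topology[symmetric] by blast
    then have "closedin ?X (down_set ((carrier L - \<Union>F) \<inter> B))"
      using B up by (rule closedin_down_set_Int_compactin)
    then show "openin ?X (W F)"
      unfolding W_def topspace_scott_topology[symmetric] by blast
  qed
  moreover have "A \<subseteq> \<Union>(W ` ?S)"
  proof
    fix a assume a: "a \<in> A"
    show "a \<in> \<Union>(W ` ?S)"
    proof -
      \<comment> \<open>Since \<open>A\<close> is an upper set, the left side is contained in
        \<open>A \<inter> B\<close>.\<close>
      have "{y \<in> carrier L. a \<sqsubseteq> y} \<inter> B \<subseteq> \<Union>\<U>"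
        using U upA[OF a] by blast
      then obtain F where F: "finite F" "F \<subseteq> \<U>" "{y \<in> carrier L. a \<sqsubseteq> y} \<inter> B \<subseteq> \<Union>F"
        using prin[OF a] U unfolding compactin_def by meson
      then have "a \<in> W F" using a AL unfolding W_def down_set_def by blast
      with F show ?thesis by blast
    qed
  qed
  ultimately obtain \<G> where G: "finite \<G>" "\<G> \<subseteq> W ` ?S" "A \<subseteq> \<Union>\<G>"
    using A unfolding compactin_def by meson
  then obtain T where T: "T \<subseteq> ?S" "finite T" "\<G> = W ` T"
    using finite_subset_image[OF G(1,2)] by blast
  have "A \<inter> B \<subseteq> \<Union>(\<Union>T)"
  proof
    fix c assume c: "c \<in> A \<inter> B"
    then obtain F where F: "F \<in> T" "c \<in> W F" using G T by blast
    have "c \<in> carrier L" using c AL by blast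
    \<comment> \<open>By reflexivity, \<open>c\<close> is one of the points of \<open>B\<close>
      above \<open>c\<close>.\<close>
    then have "c \<in> \<Union>F" using F c unfolding W_def down_set_def by blast
    with F show "c \<in> \<Union>(\<Union>T)" by blast
  qed
  with T show "\<exists>\<F>. finite \<F> \<and> \<F> \<subseteq> \<U> \<and> A \<inter> B \<subseteq> \<Union>\<F>"
    by (intro exI[of _ "\<Union>T"]) auto
qed

text \<open>If nonempty, the intersection is the principal upper set of the supremum of
  \<open>x\<close> and \<open>y\<close>, which exists because the pair is bounded.\<close>

lemma compactin_Int_principal_up:
  assumes x: "x \<in> carrier L" and y: "y \<in> carrier L"
  shows "compactin (scott_topology L) ({z \<in> carrier L. x \<sqsubseteq> z} \<inter> {z \<in> carrier L. y \<sqsubseteq> z})"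
    (is "compactin _ ?I")
proof (cases "?I = {}")
  case False
  then obtain s where s: "is_lub L s {x, y}"
    using bounded_pair_has_lub x y by blast
  have xy: "{x, y} \<subseteq> carrier L" using x y by simp
  have sL: "s \<in> carrier L" and xs: "x \<sqsubseteq> s" and ys: "y \<sqsubseteq> s"
    and sle: "\<And>z. z \<in> carrier L \<Longrightarrow> x \<sqsubseteq> z \<Longrightarrow> y \<sqsubseteq> z \<Longrightarrow> s \<sqsubseteq> z"
    using s unfolding is_lub_iff[OF xy] by auto
  have "?I = {z \<in> carrier L. s \<sqsubseteq> z}"
    using sle le_trans[OF xs _ x sL] le_trans[OF ys _ y sL] by auto
  with compactin_principal_up[OF sL] show ?thesis by simp
next
  case True
  then show ?thesis by (simp only: compactin_empty)
qed

lemma coherent_space_scott_topology: "coherent_space (scott_topology L)"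
  unfolding coherent_space_def
proof (intro conjI allI impI t0_space_scott_topology)
  let ?X = "scott_topology L"
  let ?up = "\<lambda>x. {y \<in> carrier L. x \<sqsubseteq> y}"
  fix A B
  assume asm: "compactin ?X A \<and> saturated_in ?X A \<and> compactin ?X B \<and> saturated_in ?X B"
  then have AL: "A \<subseteq> carrier L" and BL: "B \<subseteq> carrier L"
    by (auto simp: compactin_def topspace_scott_topology)
  have upA: "\<And>x y. x \<in> A \<Longrightarrow> y \<in> carrier L \<Longrightarrow> x \<sqsubseteq> y \<Longrightarrow> y \<in> A"
    and upB: "\<And>x y. x \<in> B \<Longrightarrow> y \<in> carrier L \<Longrightarrow> x \<sqsubseteq> y \<Longrightarrow> y \<in> B"
    using saturated_in_scott_topology_upper asm by blast+
  \<comment> \<open>The reduction to principal upper sets is used twice: here it replaces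
    \<open>B\<close> by the sets \<open>?up b\<close>, and afterwards it replaces \<open>A\<close>
    by the sets \<open>?up a\<close>.\<close>
  have "compactin ?X (?up a \<inter> B)" if "a \<in> A" for a
  proof -
    have a: "a \<in> carrier L" using that AL by blast
    have "compactin ?X (B \<inter> ?up a)"
    proof (rule compactin_Int_if_principal)
      show "compactin ?X B" using asm by blast
      show "compactin ?X (?up a)" by (rule compactin_principal_up[OF a])
      show "y \<in> ?up a" if "x \<in> ?up a" "y \<in> carrier L" "x \<sqsubseteq> y" for x y
        using that a le_trans by blast
      show "compactin ?X (?up b \<inter> ?up a)" if "b \<in> B" for b
        using that BL a compactin_Int_principal_up by blast
    qed (use upB in blast)
    then show ?thesis by (simp add: Int_commute)
  qed
  with asm upA upB show "compactin ?X (A \<inter> B)"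
    using compactin_Int_if_principal by blast
qed

end

section \<open>The Smyth order of a coherent well-filtered space\<close>

lemma is_lub_smyth_order_Inter:
  assumes "\<D> \<subseteq> compact_saturated X" "\<Inter>\<D> \<in> compact_saturated X"
  shows "is_lub (smyth_order X) (\<Inter>\<D>) \<D>"
  unfolding least_def
proof (intro conjI ballI)
  show "Upper (smyth_order X) \<D> \<subseteq> carrier (smyth_order X)" by simp
  show "\<Inter>\<D> \<in> Upper (smyth_order X) \<D>"
    using assms by (auto simp: Upper_def smyth_order_def)
  fix S assume "S \<in> Upper (smyth_order X) \<D>"
  then have "\<forall>D\<in>\<D>. S \<subseteq> D"
    using assms(1) by (auto simp: Upper_def smyth_order_def)
  then show "\<Inter>\<D> \<sqsubseteq>\<^bsub>smyth_order X\<^esub> S"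
    by (simp add: smyth_order_def Inter_greatest)
qed

lemma well_filtered_space_Inter_compact_saturated:
  assumes wf: "well_filtered_space X" and sub: "\<D> \<subseteq> compact_saturated X"
    and filt: "filtered_family \<D>"
  shows "\<Inter>\<D> \<in> compact_saturated X"
  unfolding compact_saturated_def
proof (intro CollectI conjI)
  have wfD: "\<exists>K\<in>\<D>. K \<subseteq> U" if "openin X U" "\<Inter>\<D> \<subseteq> U" for U
    using wf sub filt that unfolding well_filtered_space_def by blast
  have ne: "\<D> \<noteq> {}" using filt by (simp add: filtered_family_def)
  \<comment> \<open>If the intersection were empty, well-filteredness with the open set
    \<open>{}\<close> would make some member of \<open>\<D>\<close> empty.\<close>
  show "\<Inter>\<D> \<noteq> {}"
    using wfD[of "{}"] sub by (auto simp: compact_saturated_def)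
  show "saturated_in X (\<Inter>\<D>)"
    using ne sub by (intro saturated_in_Inter) (auto simp: compact_saturated_def)
  then show "compactin X (\<Inter>\<D>)"
    unfolding compactin_def
  proof (intro conjI allI impI)
    fix \<U> assume U: "Ball \<U> (openin X) \<and> \<Inter>\<D> \<subseteq> \<Union>\<U>"
    \<comment> \<open>Well-filteredness, applied to the union of the cover, finds a member covered
      by \<open>\<U>\<close>; its finite subcover also covers the smaller intersection.\<close>
    then obtain K where K: "K \<in> \<D>" "K \<subseteq> \<Union>\<U>"
      using wfD[of "\<Union>\<U>"] by (auto intro: openin_Union)
    then have "compactin X K" using sub by (auto simp: compact_saturated_def)
    then obtain \<F> where F: "finite \<F>" "\<F> \<subseteq> \<U>" "K \<subseteq> \<Union>\<F>"
      using K U unfolding compactin_def by meson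
    have "\<Inter>\<D> \<subseteq> \<Union>\<F>" using K(1) F(3) by (meson Inter_lower subset_trans)
    with F show "\<exists>\<F>. finite \<F> \<and> \<F> \<subseteq> \<U> \<and> \<Inter>\<D> \<subseteq> \<Union>\<F>" by blast
  qed (simp add: saturated_in_def)
qed

text \<open>Directed for reverse inclusion means filtered, so well-filteredness provides directed
  suprema as intersections. For a pair, coherence gives compactness, and the upper bound
  \<open>C\<close> makes the intersection nonempty.\<close>

lemma bounded_complete_dcpo_smyth_order:
  assumes coh: "coherent_space X" and wf: "well_filtered_space X"
  shows "bounded_complete_dcpo (smyth_order X)"
proof -
  interpret partial_order "smyth_order X" by (rule partial_order_smyth_order)
  show ?thesis
  proof unfold_locales
    fix \<D> assume "directed_in (smyth_order X) \<D>"
    then have "\<D> \<subseteq> compact_saturated X" "filtered_family \<D>"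
      by (auto simp: directed_in_def filtered_family_def smyth_order_def)
    then show "\<exists>S. is_lub (smyth_order X) S \<D>"
      using is_lub_smyth_order_Inter well_filtered_space_Inter_compact_saturated[OF wf] by blast
  next
    fix A B C
    assume "A \<in> carrier (smyth_order X)" "B \<in> carrier (smyth_order X)"
      "C \<in> carrier (smyth_order X)" "A \<sqsubseteq>\<^bsub>smyth_order X\<^esub> C" "B \<sqsubseteq>\<^bsub>smyth_order X\<^esub> C"
    then have AB: "{A, B} \<subseteq> compact_saturated X" and C: "C \<noteq> {}" "C \<subseteq> A \<inter> B"
      by (auto simp: smyth_order_def compact_saturated_def)
    then have "compactin X (A \<inter> B)"
      using coh by (auto simp: coherent_space_def compact_saturated_def)
    moreover have "saturated_in X (\<Inter>{A, B})"
      using AB by (intro saturated_in_Inter) (auto simp: compact_saturated_def)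
    ultimately have "\<Inter>{A, B} \<in> compact_saturated X"
      using C by (auto simp: compact_saturated_def)
    then show "\<exists>S. is_lub (smyth_order X) S {A, B}"
      using is_lub_smyth_order_Inter[OF AB] by blast
  qed
qed

theorem proposition6p6:
  fixes X :: "'a topology"
  assumes "coherent_space X" and "well_filtered_space X"
  shows "coherent_space (scott_power_space X) \<and>
         well_filtered_space (scott_power_space X) \<and>
         strong_R_space (scott_power_space X) \<and>
         strongly_well_filtered_space (scott_power_space X)"
proof -
  interpret bounded_complete_dcpo "smyth_order X"
    using assms by (rule bounded_complete_dcpo_smyth_order)
  have "coherent_space (scott_power_space X)" "well_filtered_space (scott_power_space X)"
    unfolding scott_power_space_def
    by (rule coherent_space_scott_topology well_filtered_space_scott_topology)+
  then show ?thesis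
    using coherent_well_filtered_imp_strong_R_space strong_R_imp_strongly_well_filtered_space
    by blast
qed

end
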